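(* Let $(X,d)$ be a complete semimetric space with triangle function $\Phi$, where $\Phi$ is one of $\Phi(u,v)=u+v$, $\Phi(u,v)=\max\{u,v\}$, or $\Phi(u,v)=(u^q+v^q)^{1/q}$ with $q>0$. Let $T\colon X\to X$ be a mapping for which there exists $\beta$ with $0\le\beta<1$ such that $$d(Tx,Ty)\le \beta\max\{d(x,Tx),d(y,Ty)\}\quad\text{for all } x,y\in X.$$ Then $T$ has a unique fixed point $x^*$. Moreover, for every $x_0\in X$, with $x_n=T^nx_0$, for all $n\ge 0$: $$d(x_n,x^* )\le\frac{\beta^n}{1-\beta}\,d(x_0,x_1)\quad\text{if }\Phi(u,v)=u+v,$$ $$d(x_n,x^* )\le\beta^n\,d(x_0,x_1)\quad\text{if }\Phi(u,v)=\max\{u,v\},$$ $$d(x_n,x^* )\le\frac{\beta^n}{(1-\beta^q)^{1/q}}\,d(x_0,x_1)\quad\text{if }\Phi(u,v)=(u^q+v^q)^{1/q},\ q>0.$$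
   Context: $\mathbb{R}^+=[0,\infty)$. A semimetric space $(X,d)$ is a nonempty set $X$ with a function $d\colon X\times X\to\mathbb{R}^+$ such that for all $x,y\in X$: $d(x,y)=0$ if and only if $x=y$, and $d(x,y)=d(y,x)$. A function $\Phi\colon\mathbb{R}^+\times\mathbb{R}^+\to\mathbb{R}^+$ is a triangle function for $d$ if $\Phi$ is symmetric and non-decreasing in both of its arguments, $\Phi(0,0)=0$, and $d(x,y)\le\Phi(d(x,z),d(z,y))$ for all $x,y,z\in X$. A sequence $(x_n)$ in $X$ converges to $x\in X$ if $d(x_n,x)\to 0$; it is Cauchy if $d(x_n,x_m)\to 0$ as $n,m\to\infty$; $(X,d)$ is complete if every Cauchy sequence converges to some point of $X$. Convention: $0^0=1$. *)

theory Defs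
  imports "HOL-Analysis.Analysis"
begin

locale semimetric_space =
  fixes X :: "'a set" and d :: "'a \<Rightarrow> 'a \<Rightarrow> real"
  assumes nonempty: "X \<noteq> {}"
    and nonneg: "\<lbrakk>x \<in> X; y \<in> X\<rbrakk> \<Longrightarrow> 0 \<le> d x y"
    and zero_iff: "\<lbrakk>x \<in> X; y \<in> X\<rbrakk> \<Longrightarrow> d x y = 0 \<longleftrightarrow> x = y"
    and commute: "\<lbrakk>x \<in> X; y \<in> X\<rbrakk> \<Longrightarrow> d x y = d y x"
begin

definition converges_to :: "(nat \<Rightarrow> 'a) \<Rightarrow> 'a \<Rightarrow> bool" where
  "converges_to s x \<longleftrightarrow> range s \<subseteq> X \<and> x \<in> X \<and> (\<lambda>n. d (s n) x) \<longlonglongrightarrow> 0"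

definition cauchy_seq :: "(nat \<Rightarrow> 'a) \<Rightarrow> bool" where
  "cauchy_seq s \<longleftrightarrow> range s \<subseteq> X \<and>
     ((\<lambda>(n, m). d (s n) (s m)) \<longlongrightarrow> 0) (sequentially \<times>\<^sub>F sequentially)"

definition complete_space :: bool where
  "complete_space \<longleftrightarrow> (\<forall>s. cauchy_seq s \<longrightarrow> (\<exists>x. converges_to s x))"

(* A function on [0,\<infinity>) x [0,\<infinity>) is represented by a total function on the
   reals whose values at negative arguments are left unconstrained. *)
definition triangle_function :: "(real \<Rightarrow> real \<Rightarrow> real) \<Rightarrow> bool" where
  "triangle_function \<Phi> \<longleftrightarrow>
     (\<forall>u\<ge>0. \<forall>v\<ge>0. 0 \<le> \<Phi> u v) \<and>
     (\<forall>u\<ge>0. \<forall>v\<ge>0. \<Phi> u v = \<Phi> v u) \<and>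
     (\<forall>u u' v v'. 0 \<le> u \<and> u \<le> u' \<and> 0 \<le> v \<and> v \<le> v' \<longrightarrow> \<Phi> u v \<le> \<Phi> u' v') \<and>
     \<Phi> 0 0 = 0 \<and>
     (\<forall>x\<in>X. \<forall>y\<in>X. \<forall>z\<in>X. d x y \<le> \<Phi> (d x z) (d z y))"

end

definition equal_on_nonneg :: "(real \<Rightarrow> real \<Rightarrow> real) \<Rightarrow> (real \<Rightarrow> real \<Rightarrow> real) \<Rightarrow> bool" where
  "equal_on_nonneg \<Phi> \<Psi> \<longleftrightarrow> (\<forall>u\<ge>0. \<forall>v\<ge>0. \<Phi> u v = \<Psi> u v)"

end

theory Submission
  imports Defs
begin

text \<open>
  Write \<open>a\<^sub>n = d (T\<^sup>n x\<^sub>0) (T\<^sup>n\<^sup>+\<^sup>1 x\<^sub>0)\<close>. The contraction condition applied to two consecutive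
  iterates gives \<open>a\<^sub>n\<^sub>+\<^sub>1 \<le> \<beta> max a\<^sub>n a\<^sub>n\<^sub>+\<^sub>1\<close>, hence \<open>a\<^sub>n \<le> \<beta>\<^sup>n a\<^sub>0\<close>. Applied to two arbitrary
  iterates it bounds their distance by the larger of the two preceding steps, so an orbit is Cauchy
  without summing any chain of triangle inequalities.

  The triangle function enters only at two places. That the limit \<open>x\<close> of an orbit is a fixed point
  follows from \<open>d x (T x) \<le> \<Phi> \<epsilon> (\<beta> d x (T x))\<close> for arbitrarily small \<open>\<epsilon>\<close>, together with continuity
  of \<open>\<Phi>\<close> in its first argument and \<open>\<Phi> 0 v = v\<close> (lemma \<open>limit_of_orbit_is_fixed_point\<close>). For the
  error estimates, the contraction condition for an iterate and the fixed point already gives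
  \<open>d (T\<^sup>n x\<^sub>0) x \<le> \<beta>\<^sup>n a\<^sub>0\<close> whenever \<open>n \<ge> 1\<close>, and for \<open>n = 0\<close> a single triangle inequality gives
  \<open>d x\<^sub>0 x \<le> \<Phi> a\<^sub>0 (\<beta> a\<^sub>0)\<close>. Thus any \<open>C \<ge> 1\<close> with \<open>\<Phi> a (\<beta> a) \<le> C a\<close> for all \<open>a \<ge> 0\<close> is an admissible
  constant (lemma \<open>error_estimate\<close>), and it remains to verify this for the three triangle functions.
\<close>

section \<open>Orbits of Bianchini contractions\<close>

text \<open>Mappings with this contraction condition are known as Bianchini contractions.\<close>

locale bianchini_contraction = semimetric_space +
  fixes T :: "'a \<Rightarrow> 'a" and \<beta> :: real
  assumes self_map: "T \<in> X \<rightarrow> X"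
    and beta_nonneg: "0 \<le> \<beta>" and beta_less_1: "\<beta> < 1"
    and contraction: "\<lbrakk>x \<in> X; y \<in> X\<rbrakk> \<Longrightarrow> d (T x) (T y) \<le> \<beta> * max (d x (T x)) (d y (T y))"
begin

lemma maps_into [intro]: "x \<in> X \<Longrightarrow> T x \<in> X"
  using self_map by auto

lemma orbit_in [intro]: "x \<in> X \<Longrightarrow> (T ^^ n) x \<in> X"
  by (induction n) auto

lemma self_distance: "x \<in> X \<Longrightarrow> d x x = 0"
  using zero_iff by blast

lemma triangle_functionD:
  assumes "triangle_function \<Phi>"
  shows "\<lbrakk>x \<in> X; y \<in> X; z \<in> X\<rbrakk> \<Longrightarrow> d x y \<le> \<Phi> (d x z) (d z y)"
    and "\<lbrakk>0 \<le> u; 0 \<le> v; v \<le> v'\<rbrakk> \<Longrightarrow> \<Phi> u v \<le> \<Phi> u v'"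
  using assms by (simp_all add: triangle_function_def)

text \<open>Since \<open>\<beta> < 1\<close>, the maximum in the contraction condition for \<open>x\<close> and \<open>T x\<close> cannot be
  attained by \<open>d (T x) (T (T x))\<close> unless that distance vanishes.\<close>

lemma step_contracts:
  assumes "x \<in> X"
  shows "d (T x) (T (T x)) \<le> \<beta> * d x (T x)"
proof (cases "d (T x) (T (T x)) \<le> d x (T x)")
  case True
  then show ?thesis using contraction[of x "T x"] assms by (auto simp: max_def split: if_splits)
next
  case False
  then have le: "d (T x) (T (T x)) \<le> \<beta> * d (T x) (T (T x))"
    using contraction[of x "T x"] assms by (auto simp: max_def)
  have "0 \<le> d x (T x)"
    using assms by (intro nonneg) auto
  with False have "\<beta> * d (T x) (T (T x)) < 1 * d (T x) (T (T x))"
    using beta_less_1 by (intro mult_strict_right_mono) auto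
  with le show ?thesis by simp
qed

lemma orbit_step_le:
  assumes "x \<in> X"
  shows "d ((T ^^ n) x) (T ((T ^^ n) x)) \<le> \<beta> ^ n * d x (T x)"
proof (induction n)
  case (Suc n)
  have "d ((T ^^ Suc n) x) (T ((T ^^ Suc n) x)) \<le> \<beta> * d ((T ^^ n) x) (T ((T ^^ n) x))"
    using step_contracts[of "(T ^^ n) x"] assms by auto
  also have "\<dots> \<le> \<beta> * (\<beta> ^ n * d x (T x))"
    using Suc beta_nonneg by (rule mult_left_mono)
  finally show ?case by simp
qed simp

lemma orbit_steps_tendsto_0:
  assumes "x \<in> X"
  shows "(\<lambda>n. d ((T ^^ n) x) (T ((T ^^ n) x))) \<longlonglongrightarrow> 0"
proof -
  have lim: "(\<lambda>n. \<beta> ^ n * d x (T x)) \<longlonglongrightarrow> 0"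
    using beta_nonneg beta_less_1 by (intro tendsto_mult_left_zero LIMSEQ_power_zero) auto
  have "0 \<le> d ((T ^^ n) x) (T ((T ^^ n) x))" for n
    using assms by (intro nonneg) auto
  then show ?thesis
    using orbit_step_le[OF assms] by (intro tendsto_sandwich[OF _ _ tendsto_const lim]) auto
qed

text \<open>The distance of two iterates is controlled by the two steps leading to them, so it tends
  to \<open>0\<close> as soon as the steps do. The orbit is started at \<open>T x\<close> so that each of its terms is an
  image under \<open>T\<close>.\<close>

lemma orbit_cauchy:
  assumes "x \<in> X"
  shows "cauchy_seq (\<lambda>n. T ((T ^^ n) x))"
  unfolding cauchy_seq_def
proof
  let ?a = "\<lambda>n. d ((T ^^ n) x) (T ((T ^^ n) x))"
  show "range (\<lambda>n. T ((T ^^ n) x)) \<subseteq> X"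
    using assms by auto
  have fst: "((\<lambda>p. ?a (fst p)) \<longlongrightarrow> 0) (sequentially \<times>\<^sub>F sequentially)"
    by (rule filterlim_compose[OF orbit_steps_tendsto_0[OF assms] filterlim_fst])
  have snd: "((\<lambda>p. ?a (snd p)) \<longlongrightarrow> 0) (sequentially \<times>\<^sub>F sequentially)"
    by (rule filterlim_compose[OF orbit_steps_tendsto_0[OF assms] filterlim_snd])
  have lim: "((\<lambda>p. \<beta> * max (?a (fst p)) (?a (snd p))) \<longlongrightarrow> 0) (sequentially \<times>\<^sub>F sequentially)"
    using tendsto_mult[OF tendsto_const tendsto_max[OF fst snd], of \<beta>] by simp
  show "((\<lambda>(n, m). d (T ((T ^^ n) x)) (T ((T ^^ m) x))) \<longlongrightarrow> 0) (sequentially \<times>\<^sub>F sequentially)"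
  proof (rule tendsto_sandwich[OF _ _ tendsto_const lim])
    show "\<forall>\<^sub>F p in sequentially \<times>\<^sub>F sequentially.
        0 \<le> (case p of (n, m) \<Rightarrow> d (T ((T ^^ n) x)) (T ((T ^^ m) x)))"
      using assms by (intro always_eventually) (auto intro!: nonneg)
    show "\<forall>\<^sub>F p in sequentially \<times>\<^sub>F sequentially.
        (case p of (n, m) \<Rightarrow> d (T ((T ^^ n) x)) (T ((T ^^ m) x))) \<le> \<beta> * max (?a (fst p)) (?a (snd p))"
      using assms by (intro always_eventually) (auto intro!: contraction)
  qed
qed

section \<open>Existence and uniqueness of the fixed point\<close>

text \<open>If \<open>r = d y (T y)\<close> were positive, then late iterates \<open>s\<^sub>n\<close> would satisfy
  \<open>d s\<^sub>n (T y) \<le> \<beta> r\<close>; passing to the limit in the triangle inequality through \<open>s\<^sub>n\<close> would give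
  \<open>r \<le> \<Phi> 0 (\<beta> r) = \<beta> r\<close>. Separate continuity of \<open>\<Phi>\<close> suffices because its second argument
  has been replaced by a constant first.\<close>

lemma limit_of_orbit_is_fixed_point:
  assumes tri: "triangle_function \<Phi>"
    and zero_left: "\<And>v. 0 \<le> v \<Longrightarrow> \<Phi> 0 v = v"
    and cont: "\<And>v. 0 \<le> v \<Longrightarrow> continuous_on {0..} (\<lambda>u. \<Phi> u v)"
    and "x \<in> X" and lim: "converges_to (\<lambda>n. T ((T ^^ n) x)) y"
  shows "T y = y"
proof (rule ccontr)
  define s where "s n = T ((T ^^ n) x)" for n
  define r where "r = d y (T y)"
  assume "T y \<noteq> y"
  have y: "y \<in> X" and s_lim: "(\<lambda>n. d (s n) y) \<longlonglongrightarrow> 0"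
    using lim by (auto simp: converges_to_def s_def)
  have s_in: "s n \<in> X" for n
    using \<open>x \<in> X\<close> by (auto simp: s_def)
  have "0 < r"
    using nonneg[of y "T y"] zero_iff[of y "T y"] y \<open>T y \<noteq> y\<close> by (auto simp: r_def less_le)
  then have br: "0 \<le> \<beta> * r"
    using beta_nonneg by simp
  \<comment> \<open>Once the steps of the orbit are shorter than \<open>r\<close>, the maximum in the contraction condition
    for an iterate and \<open>y\<close> is \<open>r\<close>.\<close>
  have "\<forall>\<^sub>F n in sequentially. d ((T ^^ n) x) (T ((T ^^ n) x)) < r"
    using orbit_steps_tendsto_0[OF \<open>x \<in> X\<close>] \<open>0 < r\<close> by (rule order_tendstoD(2))
  then have "\<forall>\<^sub>F n in sequentially. r \<le> \<Phi> (d (s n) y) (\<beta> * r)"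
  proof eventually_elim
    case (elim n)
    have "d (s n) (T y) \<le> \<beta> * max (d ((T ^^ n) x) (T ((T ^^ n) x))) r"
      unfolding s_def r_def using \<open>x \<in> X\<close> y by (intro contraction) auto
    with elim have "d (s n) (T y) \<le> \<beta> * r"
      by (simp add: max_def)
    then have "\<Phi> (d y (s n)) (d (s n) (T y)) \<le> \<Phi> (d y (s n)) (\<beta> * r)"
      using s_in y maps_into by (intro triangle_functionD(2)[OF tri] nonneg)
    moreover have "r \<le> \<Phi> (d y (s n)) (d (s n) (T y))"
      unfolding r_def using s_in y maps_into by (intro triangle_functionD(1)[OF tri])
    ultimately show ?case
      using commute[of y "s n"] s_in y by simp
  qed
  moreover have "(\<lambda>n. \<Phi> (d (s n) y) (\<beta> * r)) \<longlonglongrightarrow> \<Phi> 0 (\<beta> * r)"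
    by (rule continuous_on_tendsto_compose[OF cont[OF br] s_lim])
       (use nonneg s_in y in auto)
  ultimately have "r \<le> \<Phi> 0 (\<beta> * r)"
    by (intro tendsto_lowerbound) auto
  with zero_left[OF br] \<open>0 < r\<close> beta_less_1 show False
    by auto
qed

lemma fixed_point_unique:
  assumes "x \<in> X" "y \<in> X" "T x = x" "T y = y"
  shows "x = y"
proof -
  have "d x y \<le> 0"
    using contraction[of x y] assms by (simp add: self_distance)
  then show ?thesis
    using nonneg[of x y] zero_iff[of x y] assms by simp
qed

lemma ex1_fixed_point:
  assumes "complete_space" and "triangle_function \<Phi>"
    and "\<And>v. 0 \<le> v \<Longrightarrow> \<Phi> 0 v = v"
    and "\<And>v. 0 \<le> v \<Longrightarrow> continuous_on {0..} (\<lambda>u. \<Phi> u v)"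
  shows "\<exists>!x. x \<in> X \<and> T x = x"
proof -
  obtain x where x: "x \<in> X"
    using nonempty by blast
  then obtain y where y: "converges_to (\<lambda>n. T ((T ^^ n) x)) y"
    using assms(1) orbit_cauchy unfolding complete_space_def by blast
  then have "y \<in> X"
    by (simp add: converges_to_def)
  moreover have "T y = y"
    using limit_of_orbit_is_fixed_point[OF assms(2-4) x y] .
  ultimately show ?thesis
    using fixed_point_unique by blast
qed

section \<open>Error estimates\<close>

text \<open>A fixed point has step length \<open>0\<close>, so the contraction condition bounds the distance of
  \<open>T x\<close> to it by the step at \<open>x\<close> alone; only the starting point, which need not be an image
  under \<open>T\<close>, calls for the triangle inequality and hence for the constant \<open>C\<close>.\<close>

lemma error_estimate:
  assumes tri: "triangle_function \<Phi>"
    and C: "1 \<le> C" "\<And>a. 0 \<le> a \<Longrightarrow> \<Phi> a (\<beta> * a) \<le> C * a"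
    and x: "x \<in> X" and y: "y \<in> X" "T y = y"
  shows "d ((T ^^ n) x) y \<le> \<beta> ^ n * C * d x (T x)"
proof -
  have a: "0 \<le> d x (T x)"
    using x by (intro nonneg) auto
  have image_le: "d (T z) y \<le> \<beta> * d z (T z)" if "z \<in> X" for z
  proof -
    have "max (d z (T z)) (d y (T y)) = d z (T z)"
      using nonneg[OF that maps_into[OF that]] y by (simp add: self_distance max_def)
    with contraction[OF that y(1)] y(2) show ?thesis by simp
  qed
  show ?thesis
  proof (cases n)
    case 0
    have "d x y \<le> \<Phi> (d x (T x)) (d (T x) y)"
      using x y maps_into by (intro triangle_functionD(1)[OF tri])
    also have "\<dots> \<le> \<Phi> (d x (T x)) (\<beta> * d x (T x))"
      using image_le[OF x] x y(1) maps_into by (intro triangle_functionD(2)[OF tri] nonneg)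
    also have "\<dots> \<le> C * d x (T x)"
      using C(2) a .
    finally show ?thesis using 0 by simp
  next
    case (Suc m)
    have "d ((T ^^ n) x) y \<le> \<beta> * d ((T ^^ m) x) (T ((T ^^ m) x))"
      using image_le[of "(T ^^ m) x"] x Suc by auto
    also have "\<dots> \<le> \<beta> * (\<beta> ^ m * d x (T x))"
      using orbit_step_le[OF x] beta_nonneg by (rule mult_left_mono)
    also have "\<dots> = \<beta> ^ n * 1 * d x (T x)"
      using Suc by simp
    also have "\<dots> \<le> \<beta> ^ n * C * d x (T x)"
      using C(1) beta_nonneg a by (intro mult_right_mono mult_left_mono) auto
    finally show ?thesis .
  qed
qed

end

section \<open>The three triangle functions\<close>

text \<open>Put \<open>b = \<beta>\<^sup>q\<close>. The smallest constant to use in the error estimate would be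
  \<open>(1 + b)\<^sup>1\<^sup>/\<^sup>q\<close>; it is dominated by \<open>(1 / (1 - b))\<^sup>1\<^sup>/\<^sup>q\<close>.\<close>

lemma power_sum_triangle_constant:
  fixes q \<beta> :: real
  assumes "0 < q" "0 \<le> \<beta>" "\<beta> < 1"
  shows "1 \<le> 1 / (1 - \<beta> powr q) powr (1 / q)"
    and "0 \<le> a \<Longrightarrow> (a powr q + (\<beta> * a) powr q) powr (1 / q) \<le> 1 / (1 - \<beta> powr q) powr (1 / q) * a"
proof -
  define b where "b = \<beta> powr q"
  have b: "0 \<le> b" "b < 1"
    using powr_less_mono2[of q \<beta> 1] assms by (auto simp: b_def)
  have "(1 - b) powr (1 / q) \<le> 1"
    using powr_mono2[of "1 / q" "1 - b" 1] b assms by simp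
  then show "1 \<le> 1 / (1 - \<beta> powr q) powr (1 / q)"
    using b by (simp add: b_def)
  assume a: "0 \<le> a"
  \<comment> \<open>\<open>(1 + b) (1 - b) = 1 - b\<^sup>2 \<le> 1\<close>\<close>
  have "1 + b \<le> 1 / (1 - b)"
    using b by (simp add: pos_le_divide_eq algebra_simps)
  then have "(1 + b) powr (1 / q) \<le> (1 / (1 - b)) powr (1 / q)"
    using b assms by (intro powr_mono2) auto
  also have "\<dots> = 1 / (1 - b) powr (1 / q)"
    using b by (simp add: powr_divide)
  finally have le: "(1 + b) powr (1 / q) \<le> 1 / (1 - b) powr (1 / q)" .
  have "a powr q + (\<beta> * a) powr q = (1 + b) * a powr q"
    using a assms by (simp add: powr_mult b_def algebra_simps)
  then have "(a powr q + (\<beta> * a) powr q) powr (1 / q) = (1 + b) powr (1 / q) * a"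
    using a b assms by (simp add: powr_mult powr_powr)
  also have "\<dots> \<le> 1 / (1 - b) powr (1 / q) * a"
    using le a by (rule mult_right_mono)
  finally show "(a powr q + (\<beta> * a) powr q) powr (1 / q) \<le> 1 / (1 - \<beta> powr q) powr (1 / q) * a"
    by (simp add: b_def)
qed

text \<open>Values of \<open>\<Phi>\<close> at negative arguments are arbitrary, so continuity transfers from \<open>\<Psi>\<close> only
  as continuity on the half-line.\<close>

lemma equal_on_nonneg_section:
  assumes "equal_on_nonneg \<Phi> \<Psi>" and "0 \<le> v"
    and "\<Psi> 0 v = v" and "continuous_on {0..} (\<lambda>u. \<Psi> u v)"
  shows "\<Phi> 0 v = v \<and> continuous_on {0..} (\<lambda>u. \<Phi> u v)"
proof
  show "\<Phi> 0 v = v"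
    using assms by (simp add: equal_on_nonneg_def)
  have "continuous_on {0..} (\<lambda>u. \<Phi> u v) = continuous_on {0..} (\<lambda>u. \<Psi> u v)"
    using assms by (intro continuous_on_cong) (auto simp: equal_on_nonneg_def)
  with assms show "continuous_on {0..} (\<lambda>u. \<Phi> u v)" by simp
qed

theorem corollary2p5:
  fixes X :: "'a set" and d :: "'a \<Rightarrow> 'a \<Rightarrow> real" and \<Phi> :: "real \<Rightarrow> real \<Rightarrow> real"
    and T :: "'a \<Rightarrow> 'a" and \<beta> :: real
  assumes "semimetric_space X d"
    and "semimetric_space.complete_space X d"
    and "semimetric_space.triangle_function X d \<Phi>"
    and "equal_on_nonneg \<Phi> (\<lambda>u v. u + v) \<or>
         equal_on_nonneg \<Phi> (\<lambda>u v. max u v) \<or>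
         (\<exists>q>0. equal_on_nonneg \<Phi> (\<lambda>u v. (u powr q + v powr q) powr (1 / q)))"
    and "T \<in> X \<rightarrow> X"
    and "0 \<le> \<beta>" and "\<beta> < 1"
    and "\<forall>x\<in>X. \<forall>y\<in>X. d (T x) (T y) \<le> \<beta> * max (d x (T x)) (d y (T y))"
  shows "(\<exists>!x. x \<in> X \<and> T x = x) \<and>
    (\<forall>xs\<in>X. T xs = xs \<longrightarrow> (\<forall>x0\<in>X. \<forall>n.
      (equal_on_nonneg \<Phi> (\<lambda>u v. u + v) \<longrightarrow>
         d ((T ^^ n) x0) xs \<le> \<beta> ^ n / (1 - \<beta>) * d x0 (T x0)) \<and>
      (equal_on_nonneg \<Phi> (\<lambda>u v. max u v) \<longrightarrow>
         d ((T ^^ n) x0) xs \<le> \<beta> ^ n * d x0 (T x0)) \<and>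
      (\<forall>q>0. equal_on_nonneg \<Phi> (\<lambda>u v. (u powr q + v powr q) powr (1 / q)) \<longrightarrow>
         d ((T ^^ n) x0) xs \<le> \<beta> ^ n / (1 - \<beta> powr q) powr (1 / q) * d x0 (T x0))))"
proof -
  interpret bianchini_contraction X d T \<beta>
    using assms by (auto simp: bianchini_contraction_def bianchini_contraction_axioms_def)
  have section_props: "\<Phi> 0 v = v \<and> continuous_on {0..} (\<lambda>u. \<Phi> u v)" if v: "0 \<le> v" for v
    using assms(4)
  proof (elim disjE exE conjE)
    assume "equal_on_nonneg \<Phi> (\<lambda>u v. u + v)"
    then show ?thesis
      by (rule equal_on_nonneg_section) (auto intro!: continuous_intros simp: v)
  next
    assume "equal_on_nonneg \<Phi> (\<lambda>u v. max u v)"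
    then show ?thesis
      by (rule equal_on_nonneg_section) (auto intro!: continuous_intros simp: v)
  next
    fix q :: real
    assume q: "0 < q" and eq: "equal_on_nonneg \<Phi> (\<lambda>u v. (u powr q + v powr q) powr (1 / q))"
    from eq v show ?thesis
    proof (rule equal_on_nonneg_section)
      show "(0 powr q + v powr q) powr (1 / q) = v"
        using q v by (simp add: powr_powr)
      show "continuous_on {0..} (\<lambda>u. (u powr q + v powr q) powr (1 / q))"
        using q by (intro continuous_on_powr' continuous_intros) auto
    qed
  qed
  have ex1: "\<exists>!x. x \<in> X \<and> T x = x"
    using section_props by (intro ex1_fixed_point[OF assms(2,3)]) auto
  have estimates:
    "(equal_on_nonneg \<Phi> (\<lambda>u v. u + v) \<longrightarrow>
        d ((T ^^ n) x0) xs \<le> \<beta> ^ n / (1 - \<beta>) * d x0 (T x0)) \<and>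
     (equal_on_nonneg \<Phi> (\<lambda>u v. max u v) \<longrightarrow>
        d ((T ^^ n) x0) xs \<le> \<beta> ^ n * d x0 (T x0)) \<and>
     (\<forall>q>0. equal_on_nonneg \<Phi> (\<lambda>u v. (u powr q + v powr q) powr (1 / q)) \<longrightarrow>
        d ((T ^^ n) x0) xs \<le> \<beta> ^ n / (1 - \<beta> powr q) powr (1 / q) * d x0 (T x0))"
    if xs: "xs \<in> X" "T xs = xs" and x0: "x0 \<in> X" for xs x0 n
  proof (intro conjI impI allI)
    assume eq: "equal_on_nonneg \<Phi> (\<lambda>u v. u + v)"
    have C: "1 + \<beta> \<le> 1 / (1 - \<beta>)" "1 \<le> 1 / (1 - \<beta>)"
      using beta_nonneg beta_less_1 by (simp_all add: pos_le_divide_eq algebra_simps)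
    have "\<Phi> a (\<beta> * a) \<le> 1 / (1 - \<beta>) * a" if "0 \<le> a" for a
    proof -
      have "\<Phi> a (\<beta> * a) = (1 + \<beta>) * a"
        using eq that beta_nonneg by (simp add: equal_on_nonneg_def algebra_simps)
      also have "\<dots> \<le> 1 / (1 - \<beta>) * a"
        using C(1) that by (rule mult_right_mono)
      finally show ?thesis .
    qed
    from error_estimate[OF assms(3) C(2) this x0 xs, of n]
    show "d ((T ^^ n) x0) xs \<le> \<beta> ^ n / (1 - \<beta>) * d x0 (T x0)" by simp
  next
    assume eq: "equal_on_nonneg \<Phi> (\<lambda>u v. max u v)"
    have "\<Phi> a (\<beta> * a) \<le> 1 * a" if "0 \<le> a" for a
      using eq that beta_nonneg beta_less_1
      by (simp add: equal_on_nonneg_def mult_left_le_one_le)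
    from error_estimate[OF assms(3) order_refl this x0 xs, of n]
    show "d ((T ^^ n) x0) xs \<le> \<beta> ^ n * d x0 (T x0)" by simp
  next
    fix q :: real
    assume q: "0 < q" and eq: "equal_on_nonneg \<Phi> (\<lambda>u v. (u powr q + v powr q) powr (1 / q))"
    note C = power_sum_triangle_constant[OF q beta_nonneg beta_less_1]
    have "\<Phi> a (\<beta> * a) \<le> 1 / (1 - \<beta> powr q) powr (1 / q) * a" if "0 \<le> a" for a
    proof -
      have "\<Phi> a (\<beta> * a) = (a powr q + (\<beta> * a) powr q) powr (1 / q)"
        using eq that beta_nonneg by (simp add: equal_on_nonneg_def)
      with C(2)[OF that] show ?thesis by simp
    qed
    from error_estimate[OF assms(3) C(1) this x0 xs, of n]
    show "d ((T ^^ n) x0) xs \<le> \<beta> ^ n / (1 - \<beta> powr q) powr (1 / q) * d x0 (T x0)" by simp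
  qed
  show ?thesis
    using ex1 estimates by blast
qed

end
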